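(* Let $a<A<\omega$, let $\mathcal{F}$ be a class of $A$-frames, let $(\varphi,\mathbf{v},\mathbf{U})$ be an $A$-tie, and let $0<h,b<\omega$. Then $(\varphi,\mathbf{v},\mathbf{U})$ is satisfiable in $\Sigma^a_{\mathrm{Tr}(h,b)}\mathcal{F}$ if and only if the procedure $\mathrm{CSatSum}_{\mathcal{F}}(\varphi,\mathbf{v},\mathbf{U},h,b)$ (described in the context, using an oracle for conditional satisfiability in $\mathcal{F}$) returns true.
   Context: For $A<\omega$, $A$-formulas are built from variables with $\bot,\to$ and modalities $\Diamond_c$, $c<A$. An $A$-frame is $(W,(R_c)_{c<A})$, $W\ne\emptyset$; models are standard Kripke models. Conditional truth: a condition is a sequence $\Gamma=(\Gamma_c)_{c<A}$ of sets of formulas. For a model $M=(W,(R_c),\theta)$ and $w\in W$ define $M,w\models^{\Gamma}\psi$ by induction: $\bot$ is never true, variables as usual, $\to$ classically, and $M,w\models^{\Gamma}\Diamond_c\psi$ iff $\psi\in\Gamma_c$ or $M,v\models^\Gamma\psi$ for some $v$ with $wR_cv$. Let $\#\varphi$ be the number of subformulas of $\varphi$ and $\psi_0=\varphi,\psi_1,\dots,\psi_{\#\varphi-1}$ the list of its subformulas in a fixed polynomial-time computable order. A tie is a triple $(\varphi,\mathbf{v},\mathbf{U})$ with $\mathbf{v}\in 2^{\#\varphi}$ and $\mathbf{U}=(\mathbf{u}_c)_{c<A}$, $\mathbf{u}_c\in 2^{\#\varphi}$; it is satisfiable in a class $\mathcal{C}$ of $A$-frames if there is a model $M$ on a frame of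 $\mathcal{C}$ such that, with $\Gamma_c=\{\psi_i:\mathbf{u}_c(i)=1\}$, we have $\{\psi_i:\mathbf{v}(i)=1\}=\{\psi_i: M,w\models^{\Gamma}\psi_i\text{ for some }w\}$. For Boolean vectors, $\mathbf{v}+\mathbf{u}$ is componentwise disjunction; $\mathbf{U}\oplus_a\mathbf{w}$ is $\mathbf{U}$ with its $a$-th component $\mathbf{u}_a$ replaced by $\mathbf{u}_a+\mathbf{w}$. $a$-sums: for a unimodal frame $(I,S)$ and $A$-frames $\mathbf{F}_i=(W_i,(R_{i,c}))$, $\Sigma^a_{(I,S)}\mathbf{F}_i$ has domain $\{(i,w):i\in I,w\in W_i\}$, and $(i,w)R_c(j,v)$ iff ($i=j$ and $wR_{i,c}v$) or ($i\ne j$, $c=a$ and $iSj$). $\Sigma^a_{\mathcal{I}}\mathcal{F}$ is the class of all such sums with $(I,S)\in\mathcal{I}$ and all $\mathbf{F}_i\in\mathcal{F}$. A finite tree is a finite strict partial order with a least element in which the predecessors of each element form a chain; its height is the maximal size of a chain, its branching the maximal number of immediate successors of an element. $\mathrm{Tr}(h,b)$ is the class of finite trees of height $\le h$ and branching $\le b$. Procedure $\mathrm{CSatSum}_{\mathcal{F}}(\varphi,\mathbf{v},\mathbf{U},h,b)$: if the tie $(\varphi,\mathbf{v},\mathbf{U})$ is satisfiable in $\mathcal{F}$ (oracle query), return true. Otherwise, if $h>1$: for each $k$ with $1\le k\le b$ and each $\mathbf{u},\mathbf{v}_0,\dots,\mathbf{v}_{k-1}\in 2^{\#\varphi}$ with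 $\mathbf{v}=\mathbf{u}+\sum_{i<k}\mathbf{v}_i$: if the tie $(\varphi,\mathbf{u},\mathbf{U}\oplus_a\sum_{i<k}\mathbf{v}_i)$ is satisfiable in $\mathcal{F}$ (oracle query) and $\mathrm{CSatSum}_{\mathcal{F}}(\varphi,\mathbf{v}_i,\mathbf{U},h-1,b)$ returns true for every $i<k$, return true. Finally return false. *)

theory Defs
  imports Complex_Main "HOL-Library.Infinite_Typeclass"
begin

section \<open>Formulas, frames, conditional truth\<close>

datatype fm = Var nat | Bot | Imp fm fm | Dia nat fm

primrec is_formula :: "nat \<Rightarrow> fm \<Rightarrow> bool" where
  "is_formula A (Var p) = True"
| "is_formula A Bot = True"
| "is_formula A (Imp \<phi> \<psi>) = (is_formula A \<phi> \<and> is_formula A \<psi>)"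
| "is_formula A (Dia c \<phi>) = (c < A \<and> is_formula A \<phi>)"

primrec subformulas :: "fm \<Rightarrow> fm set" where
  "subformulas (Var p) = {Var p}"
| "subformulas Bot = {Bot}"
| "subformulas (Imp \<phi> \<psi>) = insert (Imp \<phi> \<psi>) (subformulas \<phi> \<union> subformulas \<psi>)"
| "subformulas (Dia c \<phi>) = insert (Dia c \<phi>) (subformulas \<phi>)"

definition num_sub :: "fm \<Rightarrow> nat" where
  "num_sub \<phi> = card (subformulas \<phi>)"

text \<open>A listing fixes, for every formula \<open>\<phi>\<close>, an order \<open>\<psi>\<^sub>0 = \<phi>, \<psi>\<^sub>1, \<dots>\<close> of its subformulas
  without repetitions. Its computational complexity plays no role in the definitions below.\<close>

definition subformula_listing :: "(fm \<Rightarrow> fm list) \<Rightarrow> bool" where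
  "subformula_listing sfs \<longleftrightarrow>
     (\<forall>\<phi>. distinct (sfs \<phi>) \<and> set (sfs \<phi>) = subformulas \<phi> \<and> sfs \<phi> ! 0 = \<phi>)"

primrec preorder_subs :: "fm \<Rightarrow> fm list" where
  "preorder_subs (Var p) = [Var p]"
| "preorder_subs Bot = [Bot]"
| "preorder_subs (Imp \<phi> \<psi>) = Imp \<phi> \<psi> # remdups (preorder_subs \<phi> @ preorder_subs \<psi>)"
| "preorder_subs (Dia c \<phi>) = Dia c \<phi> # preorder_subs \<phi>"

lemma size_subformulas: "\<psi> \<in> subformulas \<phi> \<Longrightarrow> size \<psi> \<le> size \<phi>"
  by (induction \<phi>) auto

lemma set_preorder_subs: "set (preorder_subs \<phi>) = subformulas \<phi>"
  by (induction \<phi>) auto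

lemma subformula_listing_preorder_subs: "subformula_listing preorder_subs"
proof -
  have "distinct (preorder_subs \<phi>) \<and> preorder_subs \<phi> ! 0 = \<phi>" for \<phi>
    by (induction \<phi>) (auto simp: set_preorder_subs dest!: size_subformulas)
  then show ?thesis
    by (simp add: subformula_listing_def set_preorder_subs)
qed

text \<open>Only the relations \<open>rel F c\<close> with \<open>c < A\<close> belong to an \<open>A\<close>-frame \<open>F\<close>; the others are
  unconstrained and never consulted when evaluating \<open>A\<close>-formulas.\<close>

record 'w frame =
  worlds :: "'w set"
  rel :: "nat \<Rightarrow> ('w \<times> 'w) set"

definition is_frame :: "nat \<Rightarrow> 'w frame \<Rightarrow> bool" where
  "is_frame A F \<longleftrightarrow> worlds F \<noteq> {} \<and> (\<forall>c<A. rel F c \<subseteq> worlds F \<times> worlds F)"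

primrec ctruth ::
  "'w frame \<Rightarrow> (nat \<Rightarrow> 'w set) \<Rightarrow> (nat \<Rightarrow> fm set) \<Rightarrow> 'w \<Rightarrow> fm \<Rightarrow> bool" where
  "ctruth F \<theta> \<Gamma> w (Var p) = (w \<in> \<theta> p)"
| "ctruth F \<theta> \<Gamma> w Bot = False"
| "ctruth F \<theta> \<Gamma> w (Imp \<phi> \<psi>) = (ctruth F \<theta> \<Gamma> w \<phi> \<longrightarrow> ctruth F \<theta> \<Gamma> w \<psi>)"
| "ctruth F \<theta> \<Gamma> w (Dia c \<psi>) =
     (\<psi> \<in> \<Gamma> c \<or> (\<exists>v. (w, v) \<in> rel F c \<and> ctruth F \<theta> \<Gamma> v \<psi>))"

section \<open>Ties\<close>

text \<open>An element of \<open>2\<^sup>n\<close> is a Boolean list of length \<open>n\<close>; the component \<open>U\<close> of a tie is the list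
  of the vectors \<open>u\<^sub>c\<close>, \<open>c < A\<close>.\<close>

type_synonym vec = "bool list"

type_synonym tie = "fm \<times> vec \<times> vec list"

fun is_tie :: "nat \<Rightarrow> tie \<Rightarrow> bool" where
  "is_tie A (\<phi>, v, U) \<longleftrightarrow>
     is_formula A \<phi> \<and> length v = num_sub \<phi> \<and>
     length U = A \<and> (\<forall>u\<in>set U. length u = num_sub \<phi>)"

definition selected :: "(fm \<Rightarrow> fm list) \<Rightarrow> fm \<Rightarrow> vec \<Rightarrow> fm set" where
  "selected sfs \<phi> v = {sfs \<phi> ! i | i. i < num_sub \<phi> \<and> v ! i}"

definition tie_cond :: "(fm \<Rightarrow> fm list) \<Rightarrow> fm \<Rightarrow> vec list \<Rightarrow> nat \<Rightarrow> fm set" where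
  "tie_cond sfs \<phi> U c = (if c < length U then selected sfs \<phi> (U ! c) else {})"

fun tie_sat :: "(fm \<Rightarrow> fm list) \<Rightarrow> 'w frame set \<Rightarrow> tie \<Rightarrow> bool" where
  "tie_sat sfs \<C> (\<phi>, v, U) \<longleftrightarrow>
     (\<exists>F\<in>\<C>. \<exists>\<theta>. (\<forall>p. \<theta> p \<subseteq> worlds F) \<and>
        selected sfs \<phi> v =
          {sfs \<phi> ! i | i. i < num_sub \<phi> \<and>
             (\<exists>w\<in>worlds F. ctruth F \<theta> (tie_cond sfs \<phi> U) w (sfs \<phi> ! i))})"

definition vor :: "vec \<Rightarrow> vec \<Rightarrow> vec" where
  "vor u v = map2 (\<or>) u v"

definition vsum :: "nat \<Rightarrow> vec list \<Rightarrow> vec" where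
  "vsum n vs = foldr vor vs (replicate n False)"

definition oplus :: "vec list \<Rightarrow> nat \<Rightarrow> vec \<Rightarrow> vec list" where
  "oplus U a w = U[a := vor (U ! a) w]"

section \<open>Sums over finite trees\<close>

definition frame_sum ::
  "nat \<Rightarrow> 'i set \<Rightarrow> ('i \<times> 'i) set \<Rightarrow> ('i \<Rightarrow> 'w frame) \<Rightarrow> ('i \<times> 'w) frame" where
  "frame_sum a I S F =
     \<lparr> worlds = {(i, w). i \<in> I \<and> w \<in> worlds (F i)},
       rel = (\<lambda>c. {((i, w), (j, v)).
                i \<in> I \<and> w \<in> worlds (F i) \<and> j \<in> I \<and> v \<in> worlds (F j) \<and>
                (i = j \<and> (w, v) \<in> rel (F i) c \<or> i \<noteq> j \<and> c = a \<and> (i, j) \<in> S)}) \<rparr>"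

definition sum_class ::
  "nat \<Rightarrow> ('i set \<times> ('i \<times> 'i) set) set \<Rightarrow> 'w frame set \<Rightarrow> ('i \<times> 'w) frame set" where
  "sum_class a \<I> \<F> = {frame_sum a I S F | I S F. (I, S) \<in> \<I> \<and> (\<forall>i\<in>I. F i \<in> \<F>)}"

definition is_chain :: "('i \<times> 'i) set \<Rightarrow> 'i set \<Rightarrow> bool" where
  "is_chain S C \<longleftrightarrow> (\<forall>x\<in>C. \<forall>y\<in>C. x = y \<or> (x, y) \<in> S \<or> (y, x) \<in> S)"

definition finite_tree :: "'i set \<Rightarrow> ('i \<times> 'i) set \<Rightarrow> bool" where
  "finite_tree I S \<longleftrightarrow>
     finite I \<and> S \<subseteq> I \<times> I \<and> irrefl S \<and> trans S \<and>
     (\<exists>r\<in>I. \<forall>x\<in>I. x = r \<or> (r, x) \<in> S) \<and>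
     (\<forall>x\<in>I. is_chain S {y. (y, x) \<in> S})"

definition tree_height :: "'i set \<Rightarrow> ('i \<times> 'i) set \<Rightarrow> nat" where
  "tree_height I S = Max {card C | C. C \<subseteq> I \<and> is_chain S C}"

definition imm_succs :: "('i \<times> 'i) set \<Rightarrow> 'i \<Rightarrow> 'i set" where
  "imm_succs S x = {y. (x, y) \<in> S \<and> \<not> (\<exists>z. (x, z) \<in> S \<and> (z, y) \<in> S)}"

definition tree_branching :: "'i set \<Rightarrow> ('i \<times> 'i) set \<Rightarrow> nat" where
  "tree_branching I S = Max {card (imm_succs S x) | x. x \<in> I}"

text \<open>Over an infinite type \<open>'i\<close> this class contains an isomorphic copy of every finite tree of the
  given height and branching.\<close>

definition Tr :: "nat \<Rightarrow> nat \<Rightarrow> ('i set \<times> ('i \<times> 'i) set) set" where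
  "Tr h b = {(I, S). finite_tree I S \<and> tree_height I S \<le> h \<and> tree_branching I S \<le> b}"

section \<open>The decision procedure\<close>

definition vecs :: "nat \<Rightarrow> vec list" where
  "vecs n = List.n_lists n [False, True]"

text \<open>\<open>Orc\<close> is the satisfiability oracle; the three nested searches run over \<open>k\<close>, \<open>u\<close> and
  \<open>vs = [v\<^sub>0, \<dots>, v\<^bsub>k-1\<^esub>]\<close>.\<close>

function CSatSum ::
  "(tie \<Rightarrow> bool) \<Rightarrow> nat \<Rightarrow> fm \<Rightarrow> vec \<Rightarrow> vec list \<Rightarrow> nat \<Rightarrow> nat \<Rightarrow> bool" where
  "CSatSum Orc a \<phi> v U h b =
     (if Orc (\<phi>, v, U) then True
      else if h > 1 then
        list_ex (\<lambda>k.
          list_ex (\<lambda>u.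
            list_ex (\<lambda>vs.
              v = vor u (vsum (num_sub \<phi>) vs) \<and>
              Orc (\<phi>, u, oplus U a (vsum (num_sub \<phi>) vs)) \<and>
              list_all (\<lambda>v'. CSatSum Orc a \<phi> v' U (h - 1) b) vs)
            (List.n_lists k (vecs (num_sub \<phi>))))
          (vecs (num_sub \<phi>)))
        [1..<Suc b]
      else False)"
  by pat_completeness auto
termination
  by (relation "measure (\<lambda>(Orc, a, \<phi>, v, U, h, b). h)") auto

declare CSatSum.simps [simp del]

end

theory Submission
  imports Defs
begin

text \<open>A tree is a root \<open>r\<close> below the subtrees generated by its immediate successors. Each
  subtree is closed under accessibility, so truth inside it can be computed in the sum over that
  subtree alone. In the summand at \<open>r\<close>, the only effect of the rest of the tree is that
  \<open>\<Diamond>\<^sub>a \<psi>\<close> becomes true everywhere as soon as \<open>\<psi>\<close> is satisfied in some subtree, which is exactly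
  what enlarging the \<open>a\<close>-th condition expresses. Hence one step of the procedure corresponds to
  cutting a tree at its root, and conversely to grafting trees onto a new root.\<close>

section \<open>Conditional satisfaction\<close>

text \<open>The set form of the right-hand side in \<open>tie_sat\<close>: the listing is gone and
  valuations are arbitrary, which makes models easy to restrict and to glue.\<close>

definition sat_set ::
  "'w frame \<Rightarrow> (nat \<Rightarrow> 'w set) \<Rightarrow> (nat \<Rightarrow> fm set) \<Rightarrow> fm \<Rightarrow> fm set" where
  "sat_set F \<theta> \<Gamma> \<phi> = {\<psi> \<in> subformulas \<phi>. \<exists>w\<in>worlds F. ctruth F \<theta> \<Gamma> w \<psi>}"

lemma subformulas_refl: "\<phi> \<in> subformulas \<phi>"
  by (cases \<phi>) auto

lemma subformulas_trans: "\<psi> \<in> subformulas \<phi> \<Longrightarrow> subformulas \<psi> \<subseteq> subformulas \<phi>"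
  by (induction \<phi>) auto

lemma is_formula_subformulas: "is_formula A \<phi> \<Longrightarrow> \<psi> \<in> subformulas \<phi> \<Longrightarrow> is_formula A \<psi>"
  by (induction \<phi>) auto

lemma sat_set_subset: "sat_set F \<theta> \<Gamma> \<phi> \<subseteq> subformulas \<phi>"
  by (auto simp: sat_set_def)

text \<open>An \<open>A\<close>-formula uses only the relations \<open>rel F c\<close> with
  \<open>c < A\<close>, and these keep evaluation inside \<open>worlds F\<close>, where both
  valuations agree.\<close>

lemma ctruth_restrict_valuation:
  assumes "is_frame A F" "is_formula A \<psi>" "w \<in> worlds F"
  shows "ctruth F (\<lambda>p. \<theta> p \<inter> worlds F) \<Gamma> w \<psi> \<longleftrightarrow> ctruth F \<theta> \<Gamma> w \<psi>"
  using assms(2,3)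
proof (induction \<psi> arbitrary: w)
  case (Dia c \<psi>)
  then have "v \<in> worlds F" if "(w, v) \<in> rel F c" for v
    using assms(1) that by (auto simp: is_frame_def)
  then show ?case using Dia by auto
qed auto

lemma sat_set_restrict_valuation:
  assumes "is_frame A F" "is_formula A \<phi>"
  shows "sat_set F (\<lambda>p. \<theta> p \<inter> worlds F) \<Gamma> \<phi> = sat_set F \<theta> \<Gamma> \<phi>"
  unfolding sat_set_def
  using ctruth_restrict_valuation[OF assms(1)] is_formula_subformulas[OF assms(2)] by blast

section \<open>Sums of frames\<close>

lemma worlds_frame_sum [simp]:
  "(i, w) \<in> worlds (frame_sum a I S F) \<longleftrightarrow> i \<in> I \<and> w \<in> worlds (F i)"
  by (simp add: frame_sum_def)

lemma rel_frame_sum [simp]: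
  "((i, w), (j, v)) \<in> rel (frame_sum a I S F) c \<longleftrightarrow>
     i \<in> I \<and> w \<in> worlds (F i) \<and> j \<in> I \<and> v \<in> worlds (F j) \<and>
     (i = j \<and> (w, v) \<in> rel (F i) c \<or> i \<noteq> j \<and> c = a \<and> (i, j) \<in> S)"
  by (simp add: frame_sum_def)

lemma is_frame_frame_sum:
  assumes "I \<noteq> {}" "\<And>i. i \<in> I \<Longrightarrow> is_frame A (F i)"
  shows "is_frame A (frame_sum a I S F)"
  using assms unfolding is_frame_def frame_sum_def by fastforce

text \<open>Generated-submodel argument: by the second assumption no arrow of the sum leaves the
  summands indexed by \<open>J\<close>, so evaluation started there sees only data on which the two
  models agree.\<close>

lemma ctruth_frame_sum_upset:
  assumes "J \<subseteq> I"
    and "\<And>i j. i \<in> J \<Longrightarrow> j \<in> I \<Longrightarrow> (i, j) \<in> S \<Longrightarrow> j \<in> J"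
    and "\<And>i j. i \<in> J \<Longrightarrow> j \<in> J \<Longrightarrow> (i, j) \<in> S \<longleftrightarrow> (i, j) \<in> S'"
    and "\<And>i. i \<in> J \<Longrightarrow> F i = F' i"
    and "\<And>i w p. i \<in> J \<Longrightarrow> (i, w) \<in> \<theta> p \<longleftrightarrow> (i, w) \<in> \<theta>' p"
    and "i \<in> J"
  shows "ctruth (frame_sum a I S F) \<theta> \<Gamma> (i, w) \<psi> \<longleftrightarrow>
    ctruth (frame_sum a J S' F') \<theta>' \<Gamma> (i, w) \<psi>"
  using assms(6)
proof (induction \<psi> arbitrary: i w)
  case (Dia c \<psi>)
  have R: "((i, w), (j, v)) \<in> rel (frame_sum a I S F) c \<longleftrightarrow>
      ((i, w), (j, v)) \<in> rel (frame_sum a J S' F') c" for j v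
    unfolding rel_frame_sum assms(4)[OF Dia.prems]
    using Dia.prems assms(1) assms(2,3)[of i j] assms(4)[of j] by auto
  have "j \<in> J" if "((i, w), (j, v)) \<in> rel (frame_sum a J S' F') c" for j v
    using that by simp
  then show ?case using Dia.IH unfolding ctruth.simps split_paired_Ex R by blast
qed (use assms(5) in auto)

text \<open>With equal index sets, upward closure is automatic. Data outside \<open>J\<close> may
  thus be changed freely: separate models are merged in this way for soundness, and an order is cut
  down to a subtree for completeness.\<close>

lemma sat_set_frame_sum_cong:
  assumes "\<And>i j. i \<in> J \<Longrightarrow> j \<in> J \<Longrightarrow> (i, j) \<in> S \<longleftrightarrow> (i, j) \<in> S'"
    and "\<And>i. i \<in> J \<Longrightarrow> F i = F' i"
    and "\<And>i w p. i \<in> J \<Longrightarrow> (i, w) \<in> \<theta> p \<longleftrightarrow> (i, w) \<in> \<theta>' p"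
  shows "sat_set (frame_sum a J S F) \<theta> \<Gamma> \<phi> = sat_set (frame_sum a J S' F') \<theta>' \<Gamma> \<phi>"
proof -
  have "ctruth (frame_sum a J S F) \<theta> \<Gamma> (i, w) \<psi> \<longleftrightarrow>
    ctruth (frame_sum a J S' F') \<theta>' \<Gamma> (i, w) \<psi>" if "i \<in> J" for i w \<psi>
    using that by (intro ctruth_frame_sum_upset) (auto simp: assms)
  then show ?thesis
    using assms(2) by (fastforce simp: sat_set_def)
qed

text \<open>The recursion equation behind the procedure. Every \<open>J x\<close> is closed upwards,
  so \<open>V\<close> collects what is satisfied away from \<open>r\<close> in the whole sum. Each
  world over \<open>r\<close> reaches all worlds of the other summands by an \<open>a\<close>-step,
  hence these contribute to \<open>Dia a \<psi>\<close> exactly through membership of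
  \<open>\<psi>\<close> in \<open>V\<close>.\<close>

lemma sat_set_frame_sum_rooted:
  assumes F: "is_frame A (F r)" and \<phi>: "is_formula A \<phi>"
    and r: "r \<in> I" "\<And>j. j \<in> I \<Longrightarrow> j \<noteq> r \<Longrightarrow> (r, j) \<in> S"
    and J: "I - {r} = (\<Union>x\<in>X. J x)"
    and up: "\<And>x i j. x \<in> X \<Longrightarrow> i \<in> J x \<Longrightarrow> j \<in> I \<Longrightarrow> (i, j) \<in> S \<Longrightarrow> j \<in> J x"
    and V: "V = (\<Union>x\<in>X. sat_set (frame_sum a (J x) S F) \<theta> \<Gamma> \<phi>)"
  shows "sat_set (frame_sum a I S F) \<theta> \<Gamma> \<phi> =
    sat_set (F r) (\<lambda>p. {w. (r, w) \<in> \<theta> p}) (\<Gamma>(a := \<Gamma> a \<union> V)) \<phi> \<union> V"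
proof -
  let ?M = "frame_sum a I S F" and ?\<Gamma> = "\<Gamma>(a := \<Gamma> a \<union> V)"
    and ?\<theta> = "\<lambda>p. {w. (r, w) \<in> \<theta> p}"
  have sub: "ctruth ?M \<theta> \<Gamma> (i, w) \<psi> \<longleftrightarrow> ctruth (frame_sum a (J x) S F) \<theta> \<Gamma> (i, w) \<psi>"
    if "x \<in> X" "i \<in> J x" for x i w \<psi>
    using that J up by (intro ctruth_frame_sum_upset) auto
  \<comment> \<open>\<open>V\<close> is computed in the separate pieces; here it is reread as truth
    in the full sum at indices other than \<open>r\<close>.\<close>
  have V_iff: "\<psi> \<in> V \<longleftrightarrow> \<psi> \<in> subformulas \<phi> \<and>
      (\<exists>i w. i \<in> I \<and> i \<noteq> r \<and> w \<in> worlds (F i) \<and> ctruth ?M \<theta> \<Gamma> (i, w) \<psi>)" (is "_ \<longleftrightarrow> ?R") for \<psi>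
  proof
    assume "\<psi> \<in> V"
    then obtain x i w where "x \<in> X" "\<psi> \<in> subformulas \<phi>" "i \<in> J x" "w \<in> worlds (F i)"
        "ctruth (frame_sum a (J x) S F) \<theta> \<Gamma> (i, w) \<psi>"
      by (auto simp: V sat_set_def)
    then show ?R using sub J by blast
  next
    assume ?R
    then obtain i w where "\<psi> \<in> subformulas \<phi>" "i \<in> I" "i \<noteq> r" "w \<in> worlds (F i)"
        "ctruth ?M \<theta> \<Gamma> (i, w) \<psi>" by blast
    moreover from this J obtain x where "x \<in> X" "i \<in> J x" by blast
    ultimately show "\<psi> \<in> V" using sub by (fastforce simp: V sat_set_def)
  qed
  \<comment> \<open>The induction is confined to subformulas of \<open>\<phi>\<close>, because
    \<open>V\<close> records satisfaction of those only.\<close>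
  have root: "ctruth ?M \<theta> \<Gamma> (r, w) \<psi> \<longleftrightarrow> ctruth (F r) ?\<theta> ?\<Gamma> w \<psi>"
    if "\<psi> \<in> subformulas \<phi>" "w \<in> worlds (F r)" for w \<psi>
    using that
  proof (induction \<psi> arbitrary: w)
    case (Imp \<psi>1 \<psi>2)
    then have "\<psi>1 \<in> subformulas \<phi>" "\<psi>2 \<in> subformulas \<phi>"
      using subformulas_trans[OF Imp.prems(1)] subformulas_refl by auto
    then show ?case using Imp by simp
  next
    case (Dia c \<psi>)
    then have \<psi>: "\<psi> \<in> subformulas \<phi>"
      using subformulas_trans[OF Dia.prems(1)] subformulas_refl by auto
    have "c < A"
      using is_formula_subformulas[OF \<phi> Dia.prems(1)] by simp
    then have R: "v \<in> worlds (F r)" if "(w, v) \<in> rel (F r) c" for v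
      using F that by (auto simp: is_frame_def)
    \<comment> \<open>An arrow leaving the summand at \<open>r\<close> carries the label
      \<open>a\<close>, and its target can be any world over another index, whatever
      \<open>w\<close> is.\<close>
    have "(\<exists>z. ((r, w), z) \<in> rel ?M c \<and> ctruth ?M \<theta> \<Gamma> z \<psi>) \<longleftrightarrow>
        (\<exists>v. (w, v) \<in> rel (F r) c \<and> ctruth ?M \<theta> \<Gamma> (r, v) \<psi>) \<or>
        c = a \<and> (\<exists>i w. i \<in> I \<and> i \<noteq> r \<and> w \<in> worlds (F i) \<and> ctruth ?M \<theta> \<Gamma> (i, w) \<psi>)"
      using Dia.prems(2) r R unfolding split_paired_Ex rel_frame_sum by blast
    also have "\<dots> \<longleftrightarrow> (\<exists>v. (w, v) \<in> rel (F r) c \<and> ctruth (F r) ?\<theta> ?\<Gamma> v \<psi>) \<or> c = a \<and> \<psi> \<in> V"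
      using Dia.IH[OF \<psi>] R \<psi> V_iff by blast
    moreover have "\<psi> \<in> ?\<Gamma> c \<longleftrightarrow> \<psi> \<in> \<Gamma> c \<or> c = a \<and> \<psi> \<in> V"
      by simp
    ultimately show ?case unfolding ctruth.simps by blast
  qed auto
  show ?thesis
  proof (rule set_eqI)
    fix \<psi>
    have "\<psi> \<in> sat_set ?M \<theta> \<Gamma> \<phi> \<longleftrightarrow> \<psi> \<in> subformulas \<phi> \<and>
      ((\<exists>w\<in>worlds (F r). ctruth ?M \<theta> \<Gamma> (r, w) \<psi>) \<or>
       (\<exists>i w. i \<in> I \<and> i \<noteq> r \<and> w \<in> worlds (F i) \<and> ctruth ?M \<theta> \<Gamma> (i, w) \<psi>))"
      using r(1) by (fastforce simp: sat_set_def Bex_def)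
    also have "\<dots> \<longleftrightarrow> \<psi> \<in> sat_set (F r) ?\<theta> ?\<Gamma> \<phi> \<union> V"
      using root V_iff by (auto simp: sat_set_def)
    finally show "\<psi> \<in> sat_set ?M \<theta> \<Gamma> \<phi> \<longleftrightarrow> \<psi> \<in> sat_set (F r) ?\<theta> ?\<Gamma> \<phi> \<union> V" .
  qed
qed

section \<open>Boolean vectors\<close>

lemma selected_vor:
  "length u = num_sub \<phi> \<Longrightarrow> length v = num_sub \<phi> \<Longrightarrow>
    selected sfs \<phi> (vor u v) = selected sfs \<phi> u \<union> selected sfs \<phi> v"
  by (auto simp: selected_def vor_def)

lemma length_vsum: "\<forall>v\<in>set vs. length v = n \<Longrightarrow> length (vsum n vs) = n"
  by (induction vs) (auto simp: vsum_def vor_def)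

lemma selected_vsum:
  "\<forall>v\<in>set vs. length v = num_sub \<phi> \<Longrightarrow>
    selected sfs \<phi> (vsum (num_sub \<phi>) vs) = (\<Union>v\<in>set vs. selected sfs \<phi> v)"
proof (induction vs)
  case Nil
  then show ?case by (simp add: vsum_def selected_def)
next
  case (Cons v vs)
  then have "selected sfs \<phi> (vor v (vsum (num_sub \<phi>) vs)) =
      selected sfs \<phi> v \<union> selected sfs \<phi> (vsum (num_sub \<phi>) vs)"
    by (intro selected_vor length_vsum) auto
  then show ?case using Cons by (simp add: vsum_def)
qed

text \<open>Turns the oracle query for the root summand into the enlarged condition of
  \<open>sat_set_frame_sum_rooted\<close>, once \<open>w\<close> selects \<open>V\<close>.\<close>

lemma tie_cond_oplus:
  assumes "a < length U" "length (U ! a) = num_sub \<phi>" "length w = num_sub \<phi>"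
  shows "tie_cond sfs \<phi> (oplus U a w) =
    (tie_cond sfs \<phi> U)(a := tie_cond sfs \<phi> U a \<union> selected sfs \<phi> w)"
  using assms by (auto simp: fun_eq_iff tie_cond_def oplus_def nth_list_update selected_vor)

section \<open>Vectors as sets of subformulas, for a fixed listing\<close>

context
  fixes sfs :: "fm \<Rightarrow> fm list"
  assumes sfs: "subformula_listing sfs"
begin

lemma length_listing: "length (sfs \<phi>) = num_sub \<phi>"
  using sfs distinct_card[of "sfs \<phi>"] by (simp add: subformula_listing_def num_sub_def)

lemma set_listing: "set (sfs \<phi>) = subformulas \<phi>"
  using sfs by (simp add: subformula_listing_def)

lemma nth_listing_eq_iff:
  "i < num_sub \<phi> \<Longrightarrow> j < num_sub \<phi> \<Longrightarrow> sfs \<phi> ! i = sfs \<phi> ! j \<longleftrightarrow> i = j"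
  using sfs length_listing nth_eq_iff_index_eq by (metis subformula_listing_def)

lemma nth_mem_selected: "i < num_sub \<phi> \<Longrightarrow> sfs \<phi> ! i \<in> selected sfs \<phi> v \<longleftrightarrow> v ! i"
  by (auto simp: selected_def nth_listing_eq_iff)

text \<open>The listing has no repetitions, so each bit can be read off the selected set. Equations
  between vectors may then be verified on sets.\<close>

lemma selected_inj:
  assumes "length u = num_sub \<phi>" "length v = num_sub \<phi>"
    and "selected sfs \<phi> u = selected sfs \<phi> v"
  shows "u = v"
proof (rule nth_equalityI)
  fix i assume "i < length u"
  then show "u ! i = v ! i"
    using assms nth_mem_selected[of i \<phi> u] nth_mem_selected[of i \<phi> v] by simp
qed (simp add: assms)

text \<open>The surjective counterpart of \<open>selected_inj\<close>; the witness is the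
  characteristic vector of \<open>W\<close> along the listing.\<close>

lemma ex_selected:
  assumes "W \<subseteq> subformulas \<phi>"
  obtains v where "length v = num_sub \<phi>" "selected sfs \<phi> v = W"
proof
  show "length (map (\<lambda>\<psi>. \<psi> \<in> W) (sfs \<phi>)) = num_sub \<phi>"
    by (simp add: length_listing)
  have "W \<subseteq> set (sfs \<phi>)" using assms by (simp add: set_listing)
  then show "selected sfs \<phi> (map (\<lambda>\<psi>. \<psi> \<in> W) (sfs \<phi>)) = W"
    by (fastforce simp: selected_def length_listing in_set_conv_nth)
qed

text \<open>Moves the argument from vectors and listings to sets of formulas.\<close>

lemma tie_sat_iff_sat_set:
  assumes "\<And>F. F \<in> \<C> \<Longrightarrow> is_frame A F" "is_formula A \<phi>"
  shows "tie_sat sfs \<C> (\<phi>, v, U) \<longleftrightarrow>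
    (\<exists>F\<in>\<C>. \<exists>\<theta>. selected sfs \<phi> v = sat_set F \<theta> (tie_cond sfs \<phi> U) \<phi>)"
proof -
  have eq: "{sfs \<phi> ! i | i. i < num_sub \<phi> \<and>
      (\<exists>w\<in>worlds F. ctruth F \<theta> (tie_cond sfs \<phi> U) w (sfs \<phi> ! i))} =
      sat_set F \<theta> (tie_cond sfs \<phi> U) \<phi>" for F :: "'a frame" and \<theta>
    unfolding sat_set_def set_listing[symmetric] length_listing[symmetric]
    by (auto simp: in_set_conv_nth)
  \<comment> \<open>An arbitrary valuation is intersected with the worlds, which changes no truth
    value there.\<close>
  have "\<exists>\<theta>'. (\<forall>p. \<theta>' p \<subseteq> worlds F) \<and>
      sat_set F \<theta>' (tie_cond sfs \<phi> U) \<phi> = sat_set F \<theta> (tie_cond sfs \<phi> U) \<phi>"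
    if "F \<in> \<C>" for F \<theta>
    using sat_set_restrict_valuation[OF assms(1)[OF that] assms(2)]
    by (intro exI[of _ "\<lambda>p. \<theta> p \<inter> worlds F"]) auto
  then show ?thesis
    unfolding tie_sat.simps eq by metis
qed

end

text \<open>The nested list searches become quantifiers over vectors of the right length; the
  counter \<open>k\<close> survives as the length of \<open>vs\<close>.\<close>

lemma CSatSum_iff:
  "CSatSum Orc a \<phi> v U h b \<longleftrightarrow> Orc (\<phi>, v, U) \<or>
    h > 1 \<and> (\<exists>u vs. 1 \<le> length vs \<and> length vs \<le> b \<and> length u = num_sub \<phi> \<and>
      (\<forall>v'\<in>set vs. length v' = num_sub \<phi>) \<and> v = vor u (vsum (num_sub \<phi>) vs) \<and>
      Orc (\<phi>, u, oplus U a (vsum (num_sub \<phi>) vs)) \<and>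
      (\<forall>v'\<in>set vs. CSatSum Orc a \<phi> v' U (h - 1) b))"
proof -
  have vecs: "set (vecs n) = {v. length v = n}" for n
    by (auto simp: vecs_def set_n_lists)
  have "(\<exists>k\<in>{1..<Suc b}. \<exists>u\<in>{u. length u = n}.
      \<exists>vs\<in>{vs. length vs = k \<and> set vs \<subseteq> {v. length v = n}}. P u vs) \<longleftrightarrow>
    (\<exists>u vs. 1 \<le> length vs \<and> length vs \<le> b \<and> length u = n \<and>
      (\<forall>v\<in>set vs. length v = n) \<and> P u vs)"
    for n and P :: "vec \<Rightarrow> vec list \<Rightarrow> bool"
    by (auto simp: Bex_def subset_iff less_Suc_eq_le)
  then show ?thesis
    by (subst CSatSum.simps)
      (simp add: list_ex_iff list_all_iff set_n_lists vecs del: upt_Suc)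
qed

section \<open>Finite trees\<close>

text \<open>Height and branching are maxima of finite nonempty sets of numbers (the empty chain and
  the root supply members), so bounding them means bounding every member.\<close>

lemma Tr_iff:
  "(I, S) \<in> Tr h b \<longleftrightarrow> finite_tree I S \<and>
    (\<forall>C. C \<subseteq> I \<longrightarrow> is_chain S C \<longrightarrow> card C \<le> h) \<and> (\<forall>x\<in>I. card (imm_succs S x) \<le> b)"
proof (cases "finite_tree I S")
  case True
  then have fin: "finite I" and ne: "I \<noteq> {}"
    by (auto simp: finite_tree_def)
  have "{card C | C. C \<subseteq> I \<and> is_chain S C} \<subseteq> card ` Pow I" by auto
  then have 1: "finite {card C | C. C \<subseteq> I \<and> is_chain S C}"
    using fin by (meson finite_Pow_iff finite_imageI finite_subset)
  have "is_chain S {}" by (simp add: is_chain_def)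
  then have "{card C | C. C \<subseteq> I \<and> is_chain S C} \<noteq> {}" by blast
  then have "tree_height I S \<le> h \<longleftrightarrow> (\<forall>C. C \<subseteq> I \<longrightarrow> is_chain S C \<longrightarrow> card C \<le> h)"
    unfolding tree_height_def using Max_le_iff[OF 1] by blast
  moreover have "tree_branching I S \<le> b \<longleftrightarrow> (\<forall>x\<in>I. card (imm_succs S x) \<le> b)"
    unfolding tree_branching_def Setcompr_eq_image using fin ne by (subst Max_le_iff) auto
  ultimately show ?thesis using True by (simp add: Tr_def)
qed (simp add: Tr_def)

lemma Tr_mono: "(I, S) \<in> Tr h b \<Longrightarrow> h \<le> h' \<Longrightarrow> (I, S) \<in> Tr h' b"
  by (auto simp: Tr_def)

lemma finite_treeE:
  assumes "finite_tree I S"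
  obtains r where "r \<in> I" "\<And>x. x \<in> I \<Longrightarrow> x \<noteq> r \<Longrightarrow> (r, x) \<in> S" "\<And>x. (x, r) \<notin> S"
proof -
  have t: "S \<subseteq> I \<times> I" "irrefl S" "trans S" using assms by (auto simp: finite_tree_def)
  obtain r where r: "r \<in> I" "\<And>x. x \<in> I \<Longrightarrow> x \<noteq> r \<Longrightarrow> (r, x) \<in> S"
    using assms unfolding finite_tree_def by blast
  have "(x, r) \<notin> S" for x
  proof
    assume "(x, r) \<in> S"
    moreover from this have "(r, x) \<in> S" using r t by (auto simp: irrefl_def)
    ultimately show False using t by (meson irrefl_def transD)
  qed
  with r that show thesis by blast
qed

section \<open>Cutting a tree at its root\<close>

definition up_set :: "('i \<times> 'i) set \<Rightarrow> 'i \<Rightarrow> 'i set" where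
  "up_set S x = insert x (S `` {x})"

text \<open>A finite strict order is well-founded, so a first step from \<open>r\<close> towards any
  given point exists.\<close>

lemma tree_subtrees_cover:
  assumes t: "finite_tree I S" and r: "r \<in> I" "\<And>x. x \<in> I \<Longrightarrow> x \<noteq> r \<Longrightarrow> (r, x) \<in> S"
    "\<And>x. (x, r) \<notin> S"
  shows "I - {r} = (\<Union>x\<in>imm_succs S r. up_set S x)"
proof (intro set_eqI iffI)
  fix y assume y: "y \<in> I - {r}"
  have S: "finite I" "S \<subseteq> I \<times> I" "irrefl S" "trans S" using t by (auto simp: finite_tree_def)
  have "acyclic S" using S by (metis acyclic_irrefl trancl_id)
  moreover have "finite S" using S finite_subset by blast
  ultimately have wf: "wf S" by (rule finite_acyclic_wf[rotated])
  \<comment> \<open>The candidates lie strictly above \<open>r\<close> and at or below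
    \<open>y\<close>. A point strictly between \<open>r\<close> and a minimal candidate would, by
    transitivity, be a smaller candidate.\<close>
  have "y \<in> {z. (r, z) \<in> S \<and> (z = y \<or> (z, y) \<in> S)}" using y r by auto
  then obtain z where z: "(r, z) \<in> S" "z = y \<or> (z, y) \<in> S"
      "\<And>x. (x, z) \<in> S \<Longrightarrow> \<not> ((r, x) \<in> S \<and> (x = y \<or> (x, y) \<in> S))"
    by (rule wfE_min[OF wf]) blast
  then have "z \<in> imm_succs S r"
    using \<open>trans S\<close> unfolding imm_succs_def by (blast dest: transD)
  then show "y \<in> (\<Union>x\<in>imm_succs S r. up_set S x)"
    using z by (auto simp: up_set_def)
next
  fix y assume "y \<in> (\<Union>x\<in>imm_succs S r. up_set S x)"
  then show "y \<in> I - {r}"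
    using t r by (auto simp: up_set_def imm_succs_def finite_tree_def)
qed

text \<open>All points of the subtree lie above \<open>r\<close>, so adding \<open>r\<close> to one
  of its chains gives a longer chain of the whole tree: the height drops by one. Upward closure
  leaves immediate successors unchanged.\<close>

lemma subtree_in_Tr:
  assumes t: "(I, S) \<in> Tr (Suc h) b" and r: "(r, x) \<in> S" "\<And>x. (x, r) \<notin> S"
  shows "(up_set S x, S \<inter> up_set S x \<times> up_set S x) \<in> Tr h b"
proof -
  let ?J = "up_set S x" and ?S = "S \<inter> up_set S x \<times> up_set S x"
  have S: "finite I" "S \<subseteq> I \<times> I" "irrefl S" "trans S" "\<forall>x\<in>I. is_chain S {y. (y, x) \<in> S}"
    and C: "\<And>C. C \<subseteq> I \<Longrightarrow> is_chain S C \<Longrightarrow> card C \<le> Suc h"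
    and b: "\<And>x. x \<in> I \<Longrightarrow> card (imm_succs S x) \<le> b"
    using t by (auto simp: Tr_iff finite_tree_def)
  have J: "?J \<subseteq> I" using S r by (auto simp: up_set_def)
  have up: "z \<in> ?J" if "y \<in> ?J" "(y, z) \<in> S" for y z
    using that \<open>trans S\<close> by (auto simp: up_set_def dest: transD)
  have rJ: "(r, y) \<in> S" if "y \<in> ?J" for y
    using that r \<open>trans S\<close> by (auto simp: up_set_def dest: transD)
  have "finite_tree ?J ?S"
    unfolding finite_tree_def
  proof (intro conjI)
    show "finite ?J" using J S finite_subset by blast
    show "irrefl ?S" using S by (auto simp: irrefl_def)
    show "trans ?S" using S(4) unfolding trans_def by blast
    show "\<exists>r\<in>?J. \<forall>y\<in>?J. y = r \<or> (r, y) \<in> ?S" by (auto simp: up_set_def)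
    show "\<forall>x\<in>?J. is_chain ?S {y. (y, x) \<in> ?S}"
      using S(5) J unfolding is_chain_def by blast
  qed blast
  moreover have "card C \<le> h" if "C \<subseteq> ?J" "is_chain ?S C" for C
  proof -
    have "is_chain S (insert r C)" using that rJ unfolding is_chain_def by blast
    moreover have "insert r C \<subseteq> I" using that J r S by blast
    moreover have "r \<notin> C" using that rJ r(2) by blast
    moreover have "finite C" using that(1) J S(1) by (meson finite_subset)
    ultimately show ?thesis using C[of "insert r C"] by simp
  qed
  moreover have "card (imm_succs ?S y) \<le> b" if "y \<in> ?J" for y
  proof -
    have "imm_succs ?S y = imm_succs S y" using that up unfolding imm_succs_def by blast
    then show ?thesis using b that J by auto
  qed
  ultimately show ?thesis by (simp add: Tr_iff)
qed

section \<open>Grafting trees onto a new root\<close>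

text \<open>Disjoint trees do not interact, so away from \<open>r\<close> a chain stays in one tree
  and immediate successors are the old ones. The root adds at most one element to a chain, and its
  immediate successors are among the roots of the trees.\<close>

lemma graft_in_Tr:
  assumes X: "finite X" "card X \<le> b"
    and t: "\<And>x. x \<in> X \<Longrightarrow> (J x, T x) \<in> Tr h b"
    and disj: "\<And>x y. x \<in> X \<Longrightarrow> y \<in> X \<Longrightarrow> x \<noteq> y \<Longrightarrow> J x \<inter> J y = {}"
    and r: "\<And>x. x \<in> X \<Longrightarrow> r \<notin> J x"
  shows "(insert r (\<Union>x\<in>X. J x), {r} \<times> (\<Union>x\<in>X. J x) \<union> (\<Union>x\<in>X. T x)) \<in> Tr (Suc h) b"
proof -
  define I S where I_def: "I = insert r (\<Union>x\<in>X. J x)"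
    and S_def: "S = {r} \<times> (\<Union>x\<in>X. J x) \<union> (\<Union>x\<in>X. T x)"
  have tree: "finite_tree (J x) (T x)" if "x \<in> X" for x using t[OF that] by (simp add: Tr_iff)
  then have T: "finite (J x)" "T x \<subseteq> J x \<times> J x" "irrefl (T x)" "trans (T x)"
      "\<And>y. y \<in> J x \<Longrightarrow> is_chain (T x) {z. (z, y) \<in> T x}" if "x \<in> X" for x
    using that by (auto simp: finite_tree_def)
  have same: "x = x'" if "x \<in> X" "x' \<in> X" "y \<in> J x" "y \<in> J x'" for x x' y
    using that disj by blast
  have to: "(y, z) \<in> S \<longleftrightarrow> y = r \<or> (y, z) \<in> T x" if "x \<in> X" "z \<in> J x" for x y z
    using that T(2) same unfolding S_def by blast
  have from_J: "(y, z) \<in> S \<longleftrightarrow> (y, z) \<in> T x" if "x \<in> X" "y \<in> J x" for x y z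
    using that T(2) same r unfolding S_def by blast
  have to_r: "(y, r) \<notin> S" for y
    using T(2) r unfolding S_def by blast
  have from_r: "(r, z) \<in> S \<longleftrightarrow> (\<exists>x\<in>X. z \<in> J x)" for z
    using T(2) r unfolding S_def by blast
  have "finite_tree I S"
    unfolding finite_tree_def
  proof (intro conjI)
    show "finite I" using X T by (auto simp: I_def)
    show "S \<subseteq> I \<times> I" using T(2) unfolding S_def I_def by blast
    show "irrefl S" using T(3) r by (auto simp: irrefl_def S_def)
    show "trans S"
    proof (rule transI)
      fix y z w assume yz: "(y, z) \<in> S" and zw: "(z, w) \<in> S"
      \<comment> \<open>Nothing lies below \<open>r\<close>, so the middle point belongs to some
        tree, and every arrow leaving it stays in that tree.\<close>
      from yz obtain x where x: "x \<in> X" "z \<in> J x" using T(2) unfolding S_def by blast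
      with zw from_J have zw': "(z, w) \<in> T x" by blast
      with x T(2) have w: "w \<in> J x" by blast
      show "(y, w) \<in> S"
        using yz zw' to[OF x] to[OF x(1) w] T(4)[OF x(1)] by (meson transD)
    qed
    show "\<exists>r\<in>I. \<forall>x\<in>I. x = r \<or> (r, x) \<in> S" unfolding I_def S_def by blast
    show "\<forall>y\<in>I. is_chain S {z. (z, y) \<in> S}"
    proof
      fix y assume "y \<in> I"
      then consider "y = r" | x where "x \<in> X" "y \<in> J x" unfolding I_def by blast
      then show "is_chain S {z. (z, y) \<in> S}"
      proof cases
        case 1
        then show ?thesis using to_r by (simp add: is_chain_def)
      next
        case 2
        have eq: "{z. (z, y) \<in> S} = insert r {z. (z, y) \<in> T x}" using to[OF 2] by blast
        have "z \<in> J x" "(r, z) \<in> S" if "(z, y) \<in> T x" for z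
          using that T(2)[OF 2(1)] 2(1) from_r by blast+
        then show ?thesis
          using T(5)[OF 2] from_J[OF 2(1)] unfolding eq is_chain_def by simp
      qed
    qed
  qed
  moreover have "card C \<le> Suc h" if C: "C \<subseteq> I" "is_chain S C" for C
  proof -
    have "finite I" using X T by (auto simp: I_def)
    then have fin: "finite C" using C(1) by (rule finite_subset[rotated])
    have "card (C - {r}) \<le> h"
    proof (cases "C - {r} = {}")
      case False
      then obtain y x where y: "y \<in> C" "x \<in> X" "y \<in> J x" "y \<noteq> r"
        using C(1) unfolding I_def by blast
      \<comment> \<open>One element \<open>y\<close> of the chain fixes the tree: anything
        comparable to \<open>y\<close> and different from \<open>r\<close> lies in the same
        \<open>J x\<close>.\<close>
      have "z \<in> J x" if z: "z \<in> C - {r}" for z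
      proof -
        obtain x' where x': "x' \<in> X" "z \<in> J x'"
          using z C(1) unfolding I_def by blast
        have "z = y \<or> (z, y) \<in> S \<or> (y, z) \<in> S"
          using C(2) y z unfolding is_chain_def by blast
        then show ?thesis
          using from_J[OF y(2,3)] to[OF y(2,3)] T(2)[OF y(2)] y(3) z by blast
      qed
      then have sub: "C - {r} \<subseteq> J x" by blast
      then have "is_chain (T x) (C - {r})"
        using C(2) from_J[OF y(2)] unfolding is_chain_def by blast
      then show ?thesis using sub t[OF y(2)] by (simp add: Tr_iff)
    qed (simp only: card.empty)
    then show ?thesis using fin by (simp add: card_Diff_singleton_if split: if_splits)
  qed
  moreover have "card (imm_succs S y) \<le> b" if y: "y \<in> I" for y
  proof (cases "y = r")
    case True
    have "\<exists>q. q \<in> J x \<and> (\<forall>z\<in>J x. z \<noteq> q \<longrightarrow> (q, z) \<in> T x)" if "x \<in> X" for x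
      using finite_treeE[OF tree[OF that]] by metis
    \<comment> \<open>\<open>q x\<close> is the root of the tree \<open>J x\<close>. Every other
      point of \<open>J x\<close> has \<open>q x\<close> strictly between \<open>r\<close> and
      itself.\<close>
    then obtain q where q: "\<And>x. x \<in> X \<Longrightarrow> q x \<in> J x"
        "\<And>x z. x \<in> X \<Longrightarrow> z \<in> J x \<Longrightarrow> z \<noteq> q x \<Longrightarrow> (q x, z) \<in> T x" by metis
    have "imm_succs S r \<subseteq> q ` X"
    proof
      fix z assume z: "z \<in> imm_succs S r"
      then have z': "(r, z) \<in> S" "\<And>y. (r, y) \<in> S \<Longrightarrow> (y, z) \<notin> S"
        unfolding imm_succs_def by blast+
      then obtain x where x: "x \<in> X" "z \<in> J x" using from_r by blast
      then have "z = q x"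
        using z'(2)[of "q x"] q(1)[OF x(1)] q(2)[OF x] from_r from_J by blast
      then show "z \<in> q ` X" using x by blast
    qed
    then have "card (imm_succs S r) \<le> card X"
      using X(1) by (rule surj_card_le[rotated])
    then show ?thesis using X True by simp
  next
    case False
    then obtain x where x: "x \<in> X" "y \<in> J x" using y unfolding I_def by blast
    have "imm_succs S y = imm_succs (T x) y"
      unfolding imm_succs_def using from_J[OF x] from_J[OF x(1)] T(2)[OF x(1)] by blast
    then show ?thesis using t[OF x(1)] x by (simp add: Tr_iff)
  qed
  ultimately have "(I, S) \<in> Tr (Suc h) b" by (simp add: Tr_iff)
  then show ?thesis by (simp only: I_def S_def)
qed

text \<open>Choices are made one after the other, each avoiding \<open>B\<close> and all supports
  \<open>g t\<close> used so far. This is why a choice must be available against every finite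
  forbidden set.\<close>

lemma finite_disjoint_choice:
  assumes "finite X" "finite B"
    and "\<And>x B. x \<in> X \<Longrightarrow> finite B \<Longrightarrow> \<exists>t. P x t \<and> finite (g t) \<and> g t \<inter> B = {}"
  shows "\<exists>f. (\<forall>x\<in>X. P x (f x) \<and> finite (g (f x)) \<and> g (f x) \<inter> B = {}) \<and>
    (\<forall>x\<in>X. \<forall>y\<in>X. x \<noteq> y \<longrightarrow> g (f x) \<inter> g (f y) = {})"
  using assms(1,3)
proof (induction X)
  case (insert x X)
  have "\<exists>f. (\<forall>x\<in>X. P x (f x) \<and> finite (g (f x)) \<and> g (f x) \<inter> B = {}) \<and>
      (\<forall>x\<in>X. \<forall>y\<in>X. x \<noteq> y \<longrightarrow> g (f x) \<inter> g (f y) = {})"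
    by (rule insert.IH) (use insert.prems in blast)
  then obtain f where f: "\<forall>x\<in>X. P x (f x) \<and> finite (g (f x)) \<and> g (f x) \<inter> B = {}"
    "\<forall>x\<in>X. \<forall>y\<in>X. x \<noteq> y \<longrightarrow> g (f x) \<inter> g (f y) = {}" by blast
  have "finite (B \<union> (\<Union>y\<in>X. g (f y)))" using f(1) insert.hyps assms(2) by blast
  then obtain t where t: "P x t" "finite (g t)" "g t \<inter> (B \<union> (\<Union>y\<in>X. g (f y))) = {}"
    using insert.prems[of x] by blast
  show ?case
    using f t insert.hyps by (intro exI[of _ "f(x := t)"]) auto
qed simp

section \<open>Correctness of the procedure\<close>

text \<open>The set \<open>B\<close> of forbidden indices is what allows the subtrees found by the recursive calls to
  be chosen pairwise disjoint before they are grafted onto a new root.\<close>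

lemma CSatSum_sound:
  fixes \<F> :: "'w frame set" and B :: "'i::infinite set"
  assumes sfs: "subformula_listing sfs" and \<F>: "\<And>F. F \<in> \<F> \<Longrightarrow> is_frame A F"
    and \<phi>: "is_formula A \<phi>" and U: "a < length U" "length (U ! a) = num_sub \<phi>"
    and "CSatSum (tie_sat sfs \<F>) a \<phi> v U (Suc h) b" "length v = num_sub \<phi>" "finite B"
  shows "\<exists>I S F \<theta>. (I :: 'i set, S) \<in> Tr (Suc h) b \<and> I \<inter> B = {} \<and> (\<forall>i\<in>I. F i \<in> \<F>) \<and>
    selected sfs \<phi> v = sat_set (frame_sum a I S F) \<theta> (tie_cond sfs \<phi> U) \<phi>"
proof -
  let ?\<Gamma> = "tie_cond sfs \<phi> U"
  \<comment> \<open>The index set comes first in the tuple, so that \<open>fst\<close> can serve as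
    the support in \<open>finite_disjoint_choice\<close>.\<close>
  let ?good = "\<lambda>h v (I :: 'i set, S, F, \<theta>). (I, S) \<in> Tr h b \<and> (\<forall>i\<in>I. F i \<in> \<F>) \<and>
    selected sfs \<phi> v = sat_set (frame_sum a I S F) \<theta> ?\<Gamma> \<phi>"
  have tie: "tie_sat sfs \<F> (\<phi>, u, U') \<longleftrightarrow>
      (\<exists>F\<in>\<F>. \<exists>\<theta>. selected sfs \<phi> u = sat_set F \<theta> (tie_cond sfs \<phi> U') \<phi>)" for u U'
    by (rule tie_sat_iff_sat_set[OF sfs \<F> \<phi>])
  \<comment> \<open>The vectors in \<open>X\<close> index their own subtrees. Equal vectors of a
    list share one subtree, which is harmless because only the union of the selected sets enters
    \<open>V\<close>.\<close>
  have graft: "\<exists>I S F \<theta>. (I :: 'i set, S) \<in> Tr (Suc h) b \<and> I \<inter> B = {} \<and> (\<forall>i\<in>I. F i \<in> \<F>) \<and>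
      selected sfs \<phi> u \<union> V = sat_set (frame_sum a I S F) \<theta> ?\<Gamma> \<phi>"
    if X: "finite X" "card X \<le> b" and B: "finite B"
      and V: "V = (\<Union>x\<in>X. selected sfs \<phi> x)"
      and F0: "F0 \<in> \<F>" "selected sfs \<phi> u = sat_set F0 \<theta>0 (?\<Gamma>(a := ?\<Gamma> a \<union> V)) \<phi>"
      and ex: "\<And>x B. x \<in> X \<Longrightarrow> finite B \<Longrightarrow> \<exists>t. ?good h x t \<and> finite (fst t) \<and> fst t \<inter> B = {}"
    for X :: "vec set" and h u V F0 \<theta>0 and B :: "'i set"
  proof -
    obtain f where f: "\<forall>x\<in>X. ?good h x (f x) \<and> finite (fst (f x)) \<and> fst (f x) \<inter> B = {}"
        "\<forall>x\<in>X. \<forall>y\<in>X. x \<noteq> y \<longrightarrow> fst (f x) \<inter> fst (f y) = {}"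
      using finite_disjoint_choice[where P = "?good h" and g = fst, OF X(1) B ex] by blast
    define J T G \<eta> where "J x = fst (f x)" and "T x = fst (snd (f x))"
      and "G x = fst (snd (snd (f x)))" and "\<eta> x = snd (snd (snd (f x)))" for x
    have fx: "f x = (J x, T x, G x, \<eta> x)" for x
      by (simp add: J_def T_def G_def \<eta>_def)
    have t: "(J x, T x) \<in> Tr h b" and G: "\<forall>i\<in>J x. G x i \<in> \<F>"
      and sel: "selected sfs \<phi> x = sat_set (frame_sum a (J x) (T x) (G x)) (\<eta> x) ?\<Gamma> \<phi>"
      and J: "finite (J x)" "J x \<inter> B = {}" if "x \<in> X" for x
      using f(1) that unfolding fx by auto
    have disj: "J x \<inter> J y = {}" if "x \<in> X" "y \<in> X" "x \<noteq> y" for x y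
      using f(2) that unfolding fx by auto
    have "finite (B \<union> (\<Union>x\<in>X. J x))" using B X J by blast
    then obtain r where "r \<notin> B \<union> (\<Union>x\<in>X. J x)"
      using ex_new_if_finite[OF infinite_UNIV] by blast
    then have r: "r \<notin> B" "\<And>x. x \<in> X \<Longrightarrow> r \<notin> J x" by auto
    \<comment> \<open>By disjointness at most one tree contains \<open>i\<close>; \<open>ix\<close>
      names it, so that frames and valuations of the separate models can be glued.\<close>
    define ix where "ix i = (THE x. x \<in> X \<and> i \<in> J x)" for i
    have ix: "ix i = x" if "x \<in> X" "i \<in> J x" for x i
      unfolding ix_def using that disj by (intro the_equality) auto
    define F where "F i = (if i = r then F0 else G (ix i) i)" for i
    define \<theta> where "\<theta> p = {(i, w). if i = r then w \<in> \<theta>0 p else (i, w) \<in> \<eta> (ix i) p}" for p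
    define I where "I = insert r (\<Union>x\<in>X. J x)"
    define S where "S = {r} \<times> (\<Union>x\<in>X. J x) \<union> (\<Union>x\<in>X. T x)"
    have TJ: "T x \<subseteq> J x \<times> J x" if "x \<in> X" for x
      using t[OF that] by (simp add: Tr_iff finite_tree_def)
    have S: "(i, j) \<in> S \<longleftrightarrow> (i, j) \<in> T x" if "x \<in> X" "i \<in> J x" for x i j
      using that TJ disj r unfolding S_def by blast
    have F: "F i \<in> \<F>" if "i \<in> I" for i
      using that G F0 ix unfolding I_def F_def by auto
    \<comment> \<open>On \<open>J x\<close> the glued order, frames and valuation agree with those
      chosen for \<open>x\<close>.\<close>
    have "sat_set (frame_sum a (J x) S F) \<theta> ?\<Gamma> \<phi> = selected sfs \<phi> x" if "x \<in> X" for x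
      unfolding sel[OF that]
    proof (rule sat_set_frame_sum_cong)
      fix i assume i: "i \<in> J x"
      then have "i \<noteq> r" using r that by blast
      then show "F i = G x i" and "(i, w) \<in> \<theta> p \<longleftrightarrow> (i, w) \<in> \<eta> x p" for w p
        using ix[OF that i] by (auto simp: F_def \<theta>_def)
    qed (use S that in blast)
    then have V': "V = (\<Union>x\<in>X. sat_set (frame_sum a (J x) S F) \<theta> ?\<Gamma> \<phi>)"
      by (simp add: V)
    have "sat_set (frame_sum a I S F) \<theta> ?\<Gamma> \<phi> =
        sat_set (F r) (\<lambda>p. {w. (r, w) \<in> \<theta> p}) (?\<Gamma>(a := ?\<Gamma> a \<union> V)) \<phi> \<union> V"
    proof (rule sat_set_frame_sum_rooted[OF _ \<phi> _ _ _ _ V'])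
      show "is_frame A (F r)" using F \<F> by (simp add: I_def)
      show "I - {r} = (\<Union>x\<in>X. J x)" using r by (auto simp: I_def)
      show "j \<in> J x" if "x \<in> X" "i \<in> J x" "(i, j) \<in> S" for x i j
        using that S TJ by blast
    qed (auto simp: I_def S_def)
    also have "\<dots> = selected sfs \<phi> u \<union> V"
      by (simp add: F0(2) F_def \<theta>_def)
    finally have "selected sfs \<phi> u \<union> V = sat_set (frame_sum a I S F) \<theta> ?\<Gamma> \<phi>" ..
    moreover have "(I, S) \<in> Tr (Suc h) b"
      unfolding I_def S_def using X t disj r(2) by (rule graft_in_Tr)
    moreover have "I \<inter> B = {}" using r J by (auto simp: I_def)
    ultimately show ?thesis using F by blast
  qed
  \<comment> \<open>A positive oracle answer is realised on a one-point tree: grafting with no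
    subtrees leaves the condition unchanged and gives height one, which \<open>Tr_mono\<close> then
    raises.\<close>
  have single: "\<exists>I S F \<theta>. (I :: 'i set, S) \<in> Tr (Suc h) b \<and> I \<inter> B = {} \<and> (\<forall>i\<in>I. F i \<in> \<F>) \<and>
      selected sfs \<phi> v = sat_set (frame_sum a I S F) \<theta> ?\<Gamma> \<phi>"
    if v: "tie_sat sfs \<F> (\<phi>, v, U)" and B: "finite B" for h v and B :: "'i set"
  proof -
    obtain F0 \<theta>0 where "F0 \<in> \<F>" "selected sfs \<phi> v = sat_set F0 \<theta>0 ?\<Gamma> \<phi>"
      using v tie by blast
    then have "\<exists>I S F \<theta>. (I :: 'i set, S) \<in> Tr (Suc 0) b \<and> I \<inter> B = {} \<and> (\<forall>i\<in>I. F i \<in> \<F>) \<and>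
      selected sfs \<phi> v \<union> {} = sat_set (frame_sum a I S F) \<theta> ?\<Gamma> \<phi>"
      by (intro graft[of "{}", OF _ _ B]) auto
    then show ?thesis using Tr_mono[of _ _ "Suc 0" b "Suc h"] by auto
  qed
  show ?thesis
    using assms(6-8)
  \<comment> \<open>\<open>B\<close> has to vary, since each subtree is later requested with a
    different set of forbidden indices.\<close>
  proof (induction h arbitrary: v B)
    case 0
    \<comment> \<open>At height one the procedure can succeed only by its first oracle
      query.\<close>
    then have "tie_sat sfs \<F> (\<phi>, v, U)" by (subst (asm) CSatSum_iff) simp
    then show ?case using single 0 by blast
  next
    case (Suc h)
    show ?case
    proof (cases "tie_sat sfs \<F> (\<phi>, v, U)")
      case True
      then show ?thesis using single Suc.prems by blast
    next
      case False
      then obtain u vs where vs: "length vs \<le> b" "length u = num_sub \<phi>"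
          "\<forall>v'\<in>set vs. length v' = num_sub \<phi>" "v = vor u (vsum (num_sub \<phi>) vs)"
          "tie_sat sfs \<F> (\<phi>, u, oplus U a (vsum (num_sub \<phi>) vs))"
          "\<forall>v'\<in>set vs. CSatSum (tie_sat sfs \<F>) a \<phi> v' U (Suc h) b"
        using Suc.prems(1) unfolding CSatSum_iff[of _ _ _ v] diff_Suc_1 by blast
      let ?V = "\<Union>x\<in>set vs. selected sfs \<phi> x"
      have len: "length (vsum (num_sub \<phi>) vs) = num_sub \<phi>"
        using length_vsum[OF vs(3)] .
      have "tie_cond sfs \<phi> (oplus U a (vsum (num_sub \<phi>) vs)) = ?\<Gamma>(a := ?\<Gamma> a \<union> ?V)"
        by (simp add: tie_cond_oplus[OF U len] selected_vsum[OF vs(3)])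
      then obtain F0 \<theta>0 where
        F0: "F0 \<in> \<F>" "selected sfs \<phi> u = sat_set F0 \<theta>0 (?\<Gamma>(a := ?\<Gamma> a \<union> ?V)) \<phi>"
        using vs(5) unfolding tie by metis
      have "selected sfs \<phi> v = selected sfs \<phi> u \<union> ?V"
        using vs(3) by (simp add: vs(4) selected_vor[OF vs(2) len] selected_vsum)
      moreover have "\<exists>I S F \<theta>. (I :: 'i set, S) \<in> Tr (Suc (Suc h)) b \<and> I \<inter> B = {} \<and>
          (\<forall>i\<in>I. F i \<in> \<F>) \<and>
          selected sfs \<phi> u \<union> ?V = sat_set (frame_sum a I S F) \<theta> ?\<Gamma> \<phi>"
      proof (rule graft[OF _ _ Suc.prems(3) refl F0])
        \<comment> \<open>Passing from the list to its set can only lower the branching at the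
          root.\<close>
        show "card (set vs) \<le> b" using vs(1) card_length le_trans by blast
        fix x and B :: "'i set" assume x: "x \<in> set vs" and B: "finite B"
        then obtain I S F \<theta> where "(I :: 'i set, S) \<in> Tr (Suc h) b" "I \<inter> B = {}"
            "\<forall>i\<in>I. F i \<in> \<F>" "selected sfs \<phi> x = sat_set (frame_sum a I S F) \<theta> ?\<Gamma> \<phi>"
          using Suc.IH[of x B] vs(3,6) by blast
        then show "\<exists>t. ?good (Suc h) x t \<and> finite (fst t) \<and> fst t \<inter> B = {}"
          by (intro exI[of _ "(I, S, F, \<theta>)"]) (auto simp: Tr_iff finite_tree_def)
      qed simp
      ultimately show ?thesis by simp
    qed
  qed
qed

text \<open>Induction on the height, cutting the tree at its root. The summands and the valuation
  stay fixed; only the index set, the order and the vector change in recursive calls.\<close>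

lemma CSatSum_complete:
  fixes \<F> :: "'w frame set" and I :: "'i set"
  assumes sfs: "subformula_listing sfs" and \<F>: "\<And>F. F \<in> \<F> \<Longrightarrow> is_frame A F"
    and \<phi>: "is_formula A \<phi>" and U: "a < length U" "length (U ! a) = num_sub \<phi>"
    and "(I, S) \<in> Tr h b" "\<And>i. i \<in> I \<Longrightarrow> F i \<in> \<F>" "length v = num_sub \<phi>"
    and "selected sfs \<phi> v = sat_set (frame_sum a I S F) \<theta> (tie_cond sfs \<phi> U) \<phi>"
  shows "CSatSum (tie_sat sfs \<F>) a \<phi> v U h b"
  using assms(6-9)
proof (induction h arbitrary: I S v)
  case 0
  then obtain r where "r \<in> I" by (auto simp: Tr_iff finite_tree_def)
  \<comment> \<open>The root alone is a chain of size one, so no tree has height zero.\<close>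
  then have "card {r} \<le> 0"
    using 0(1) unfolding Tr_iff is_chain_def by blast
  then show ?case by simp
next
  case (Suc h)
  let ?\<Gamma> = "tie_cond sfs \<phi> U"
  have tie: "tie_sat sfs \<F> (\<phi>, u, U') \<longleftrightarrow>
      (\<exists>F\<in>\<F>. \<exists>\<theta>. selected sfs \<phi> u = sat_set F \<theta> (tie_cond sfs \<phi> U') \<phi>)" for u U'
    by (rule tie_sat_iff_sat_set[OF sfs \<F> \<phi>])
  have tree: "finite_tree I S" and S: "finite I" "S \<subseteq> I \<times> I" "trans S"
    using Suc.prems(1) by (auto simp: Tr_iff finite_tree_def)
  obtain r where r: "r \<in> I" "\<And>x. x \<in> I \<Longrightarrow> x \<noteq> r \<Longrightarrow> (r, x) \<in> S" "\<And>x. (x, r) \<notin> S"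
    using finite_treeE[OF tree] by blast
  let ?X = "imm_succs S r"
  let ?W = "\<lambda>x. sat_set (frame_sum a (up_set S x) S F) \<theta> ?\<Gamma> \<phi>"
  let ?V = "\<Union>x\<in>?X. ?W x"
  have X: "?X \<subseteq> I" "finite ?X" "card ?X \<le> b"
    using S finite_subset[of ?X I] Suc.prems(1) r(1) by (auto simp: imm_succs_def Tr_iff)
  have "sat_set (frame_sum a I S F) \<theta> ?\<Gamma> \<phi> =
      sat_set (F r) (\<lambda>p. {w. (r, w) \<in> \<theta> p}) (?\<Gamma>(a := ?\<Gamma> a \<union> ?V)) \<phi> \<union> ?V"
  proof (rule sat_set_frame_sum_rooted[OF _ \<phi> r(1,2) tree_subtrees_cover[OF tree r] _ refl])
    show "is_frame A (F r)" using \<F> Suc.prems(2) r(1) by blast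
    show "j \<in> up_set S x" if "i \<in> up_set S x" "(i, j) \<in> S" for x i j
      using that S(3) by (auto simp: up_set_def dest: transD)
  qed
  with Suc.prems(4) have v: "selected sfs \<phi> v =
      sat_set (F r) (\<lambda>p. {w. (r, w) \<in> \<theta> p}) (?\<Gamma>(a := ?\<Gamma> a \<union> ?V)) \<phi> \<union> ?V"
    by simp
  show ?case
  proof (cases "?X = {}")
    case True
    \<comment> \<open>Without immediate successors \<open>V\<close> is empty, the condition is
      unchanged, and the root summand itself satisfies the tie.\<close>
    then have "tie_sat sfs \<F> (\<phi>, v, U)"
      using v Suc.prems(2)[OF r(1)] unfolding tie by auto
    then show ?thesis by (subst CSatSum_iff) simp
  next
    case False
    then obtain x where x: "x \<in> ?X" by blast
    \<comment> \<open>A two-element chain forces the height bound past one, so the guard of the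
      recursive branch holds.\<close>
    have "is_chain S {r, x}" "{r, x} \<subseteq> I" "r \<noteq> x"
      using x r X by (auto simp: is_chain_def imm_succs_def)
    then have "card {r, x} \<le> Suc h"
      using Suc.prems(1) unfolding Tr_iff by blast
    then have h: "Suc h > 1" using \<open>r \<noteq> x\<close> by simp
    obtain xs where xs: "set xs = ?X" "distinct xs"
      using finite_distinct_list X(2) by blast
    have "\<exists>w. length w = num_sub \<phi> \<and> selected sfs \<phi> w = ?W x" for x
      using ex_selected[OF sfs sat_set_subset] by metis
    \<comment> \<open>\<open>w x\<close> encodes what is satisfied in the subtree at
      \<open>x\<close>. One vector is listed per immediate successor, so the length of the list is
      at most \<open>b\<close>.\<close>
    then obtain w where w: "\<And>x. length (w x) = num_sub \<phi>" "\<And>x. selected sfs \<phi> (w x) = ?W x"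
      by metis
    let ?vs = "map w xs"
    \<comment> \<open>\<open>u\<close> encodes what is satisfied in the root summand once its
      condition has been enlarged by \<open>V\<close>.\<close>
    obtain u where u: "length u = num_sub \<phi>" "selected sfs \<phi> u =
        sat_set (F r) (\<lambda>p. {w. (r, w) \<in> \<theta> p}) (?\<Gamma>(a := ?\<Gamma> a \<union> ?V)) \<phi>"
      using ex_selected[OF sfs sat_set_subset] by metis
    have vs: "\<forall>v'\<in>set ?vs. length v' = num_sub \<phi>" using w by simp
    have len: "length (vsum (num_sub \<phi>) ?vs) = num_sub \<phi>"
      using length_vsum[OF vs] .
    have sel: "selected sfs \<phi> (vsum (num_sub \<phi>) ?vs) = ?V"
      by (simp add: selected_vsum[OF vs] w xs del: set_map) (simp add: w xs)
    have v_eq: "v = vor u (vsum (num_sub \<phi>) ?vs)"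
    proof (rule selected_inj[OF sfs Suc.prems(3)])
      show "length (vor u (vsum (num_sub \<phi>) ?vs)) = num_sub \<phi>"
        using u(1) len by (simp add: vor_def)
      show "selected sfs \<phi> v = selected sfs \<phi> (vor u (vsum (num_sub \<phi>) ?vs))"
        by (simp only: selected_vor[OF u(1) len] sel u(2) v)
    qed
    have "tie_sat sfs \<F> (\<phi>, u, oplus U a (vsum (num_sub \<phi>) ?vs))"
      unfolding tie tie_cond_oplus[OF U len] sel using u(2) Suc.prems(2)[OF r(1)] by blast
    moreover have "CSatSum (tie_sat sfs \<F>) a \<phi> (w x) U h b" if x: "x \<in> ?X" for x
    proof (rule Suc.IH)
      \<comment> \<open>The order is restricted because membership in \<open>Tr\<close> confines it
        to the index set; \<open>sat_set\<close> does not notice the restriction.\<close>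
      show "(up_set S x, S \<inter> up_set S x \<times> up_set S x) \<in> Tr h b"
        using subtree_in_Tr[OF Suc.prems(1) _ r(3)] x by (simp add: imm_succs_def)
      have "up_set S x \<subseteq> I" using X(1) x S(2) by (auto simp: up_set_def)
      then show "F i \<in> \<F>" if "i \<in> up_set S x" for i using that Suc.prems(2) by blast
      show "selected sfs \<phi> (w x) =
          sat_set (frame_sum a (up_set S x) (S \<inter> up_set S x \<times> up_set S x) F) \<theta> ?\<Gamma> \<phi>"
        unfolding w by (rule sat_set_frame_sum_cong) auto
    qed (rule w)
    moreover have "1 \<le> length ?vs" "length ?vs \<le> b"
      using False xs X(3) distinct_card[OF xs(2)] by (auto simp: Suc_le_eq)
    ultimately show ?thesis
      using h u(1) v_eq vs xs(1)
      by (subst CSatSum_iff) (intro disjI2 conjI exI[of _ u] exI[of _ ?vs]; simp)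
  qed
qed

theorem theorem4p7:
  fixes a A h b :: nat
    and sfs :: "fm \<Rightarrow> fm list"
    and \<F> :: "'w frame set"
    and \<phi> :: fm and v :: vec and U :: "vec list"
  assumes "a < A"
    and "subformula_listing sfs"
    and "\<forall>F\<in>\<F>. is_frame A F"
    and "is_tie A (\<phi>, v, U)"
    and "0 < h" and "0 < b"
  shows "tie_sat sfs (sum_class a (Tr h b :: ('i::infinite set \<times> ('i \<times> 'i) set) set) \<F>) (\<phi>, v, U)
    \<longleftrightarrow> CSatSum (tie_sat sfs \<F>) a \<phi> v U h b"
proof -
  let ?\<C> = "sum_class a (Tr h b :: ('i set \<times> ('i \<times> 'i) set) set) \<F>"
  have tie: "is_formula A \<phi>" "length v = num_sub \<phi>" "a < length U" "length (U ! a) = num_sub \<phi>"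
    using assms(1,4) by auto
  have \<F>: "is_frame A F" if "F \<in> \<F>" for F using that assms(3) by blast
  \<comment> \<open>The root of the tree makes the index set, and hence the sum, nonempty.\<close>
  have "is_frame A G" if G: "G \<in> ?\<C>" for G
  proof -
    obtain I :: "'i set" and S F where "G = frame_sum a I S F" "(I, S) \<in> Tr h b" "\<forall>i\<in>I. F i \<in> \<F>"
      using G unfolding sum_class_def by blast
    then show ?thesis
      using \<F> by (auto simp: Tr_iff finite_tree_def intro!: is_frame_frame_sum)
  qed
  then have "tie_sat sfs ?\<C> (\<phi>, v, U) \<longleftrightarrow>
      (\<exists>G\<in>?\<C>. \<exists>\<theta>. selected sfs \<phi> v = sat_set G \<theta> (tie_cond sfs \<phi> U) \<phi>)"
    using tie_sat_iff_sat_set[OF assms(2) _ tie(1)] by blast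
  also have "\<dots> \<longleftrightarrow> (\<exists>(I :: 'i set) S F \<theta>. (I, S) \<in> Tr h b \<and> (\<forall>i\<in>I. F i \<in> \<F>) \<and>
      selected sfs \<phi> v = sat_set (frame_sum a I S F) \<theta> (tie_cond sfs \<phi> U) \<phi>)"
    unfolding sum_class_def by blast
  also have "\<dots> \<longleftrightarrow> CSatSum (tie_sat sfs \<F>) a \<phi> v U h b"
  proof
    assume "CSatSum (tie_sat sfs \<F>) a \<phi> v U h b"
    \<comment> \<open>Soundness is stated for successor heights, which is where positivity of
      \<open>h\<close> enters; no index is forbidden at the outermost level.\<close>
    moreover obtain h' where "h = Suc h'" using assms(5) gr0_implies_Suc by blast
    ultimately have sat: "CSatSum (tie_sat sfs \<F>) a \<phi> v U (Suc h') b" and h: "h = Suc h'"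
      by auto
    show "\<exists>(I :: 'i set) S F \<theta>. (I, S) \<in> Tr h b \<and> (\<forall>i\<in>I. F i \<in> \<F>) \<and>
        selected sfs \<phi> v = sat_set (frame_sum a I S F) \<theta> (tie_cond sfs \<phi> U) \<phi>"
      using CSatSum_sound[OF assms(2) \<F> tie(1,3,4) sat tie(2) finite.emptyI] unfolding h by meson
  qed (use CSatSum_complete[OF assms(2) \<F> tie(1,3,4) _ _ tie(2)] in blast)
  finally show ?thesis .
qed

end
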